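(* Let $(\Omega,\rho)$, $h$ and $\mathcal{N}^h_\Omega$ be the Davies–Rogers space, gauge function and $h$-Hausdorff null ideal described in the context, and let $\mathcal{E}$ be the $\sigma$-ideal on $2^\omega$ generated by the closed Lebesgue null sets. Then $$\operatorname{cov}(\mathcal{N}^h_\Omega)\le \operatorname{non}(\mathcal{E})\quad\text{and}\quad \operatorname{cov}(\mathcal{E})\le \operatorname{non}(\mathcal{N}^h_\Omega).$$
   Context: Davies–Rogers space. For every integer $n>0$ there exists (a known result) a finite graph $G$ (identified with its vertex set) such that: (1) $G$ cannot be partitioned into $n$ (possibly empty) independent subsets; (2) for every $w\colon G\to[0,\infty)$ there is an independent $H\subseteq G$ with $\sum_{g\in H}w(g)\ge\frac14\sum_{g\in G}w(g)$; (3) there is a family $\langle H(x):x\in G\rangle$ of independent subsets of $G$ with $x\in H(x)$ for every $x\in G$ and $|\{x\in G: a\in H(x)\}|\ge\frac14|G|$ for every $a\in G$. For each $n$ fix one such graph $G(n)$. Define recursively $M_0=1$, $G_n=G(M_n)$, $N_n=|G_n|$, $M_{n+1}=2N_n$. Let $\Omega=\prod_{n\in\omega}G_n$. For $x\ne y$ in $\Omega$, let $n$ be the least index with $x(n)\neq y(n)$ and put $\rho(x,y)=2^{-n+1}$ if $x(n),y(n)$ are adjacent in $G_n$ and $\rho(x,y)=2^{-n}$ otherwise; $\rho(x,x)=0$. This is a metric. The gauge function $h\colon[0,\infty)\to[0,\infty)$ is given by $h(0)=0$, $h(2^{-n})=\frac{1}{M_0\cdots M_n}$ for $n\in\omega$,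 linear interpolation in between, and (say) $h(t)=1$ for $t>1$. Hausdorff measure. A gauge function is a nondecreasing right-continuous $f\colon[0,\infty)\to[0,\infty)$ with $f(0)=0$. For a metric space $X$ and $A\subseteq X$, $\mathcal{H}^f_{X,\delta}(A)=\inf\{\sum_n f(\operatorname{diam}C_n): A\subseteq\bigcup_{n\in\omega} C_n,\ \operatorname{diam}C_n\le\delta \text{ for all } n\}$, $\mathcal{H}^f_X(A)=\sup_{\delta>0}\mathcal{H}^f_{X,\delta}(A)$ and $\mathcal{N}^f_X=\{A\subseteq X:\mathcal{H}^f_X(A)=0\}$. Thus $\mathcal{N}^h_\Omega$ is an ideal on $\Omega$. Cardinal invariants. For an ideal $\mathcal{I}$ on a set $X$: $\operatorname{cov}(\mathcal{I})$ is the least size of a family $F\subseteq\mathcal{I}$ with $\bigcup F=X$; $\operatorname{non}(\mathcal{I})$ is the least size of a subset of $X$ not in $\mathcal{I}$. *)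

theory Defs
  imports "HOL-Probability.Probability" "Graph_Theory.Pair_Digraph"
begin

unbundle cardinal_syntax

section \<open>Ideals and their cardinal invariants\<close>

text \<open>
  The cardinality of a member of \<open>\<A>\<close> of least size, as a cardinal order. It is unspecified if
  \<open>\<A>\<close> is empty.
\<close>

definition min_card :: "'a set set \<Rightarrow> 'a rel" where
  "min_card \<A> = |SOME A. A \<in> \<A> \<and> (\<forall>B\<in>\<A>. |A| \<le>o |B| )|"

definition cov :: "'a set \<Rightarrow> 'a set set \<Rightarrow> 'a set rel" where
  "cov X I = min_card {F. F \<subseteq> I \<and> \<Union>F = X}"

definition non :: "'a set \<Rightarrow> 'a set set \<Rightarrow> 'a rel" where
  "non X I = min_card {A. A \<subseteq> X \<and> A \<notin> I}"

lemma min_card_attained: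
  assumes "\<A> \<noteq> {}"
  obtains A where "A \<in> \<A>" "min_card \<A> = |A|" "\<And>B. B \<in> \<A> \<Longrightarrow> |A| \<le>o |B|"
proof -
  have "\<exists>r\<in>card_of ` \<A>. \<forall>r'\<in>card_of ` \<A>. r \<le>o r'"
    using assms by (intro exists_minim_Well_order) (auto simp: card_of_Well_order)
  hence "\<exists>A. A \<in> \<A> \<and> (\<forall>B\<in>\<A>. |A| \<le>o |B| )" by blast
  from someI_ex[OF this] show ?thesis
    by (intro that[of "SOME A. A \<in> \<A> \<and> (\<forall>B\<in>\<A>. |A| \<le>o |B| )"]) (auto simp: min_card_def)
qed

definition sigma_ideal :: "'a set \<Rightarrow> 'a set set \<Rightarrow> bool" where
  "sigma_ideal X I \<longleftrightarrow> I \<subseteq> Pow X \<and> {} \<in> I \<and>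
     (\<forall>A\<in>I. \<forall>B. B \<subseteq> A \<longrightarrow> B \<in> I) \<and>
     (\<forall>A :: nat \<Rightarrow> 'a set. range A \<subseteq> I \<longrightarrow> (\<Union>n. A n) \<in> I)"

definition sigma_ideal_generated :: "'a set \<Rightarrow> 'a set set \<Rightarrow> 'a set set" where
  "sigma_ideal_generated X K = \<Inter>{I. sigma_ideal X I \<and> K \<subseteq> I}"

section \<open>The ideal generated by the closed null subsets of the Cantor space\<close>

definition cantor_measure :: "(nat \<Rightarrow> bool) measure" where
  "cantor_measure = (\<Pi>\<^sub>M i\<in>UNIV. measure_pmf (bernoulli_pmf (1/2)))"

text \<open>Closedness refers to the product topology, which is the library topology on functions.\<close>

definition closed_null_ideal :: "(nat \<Rightarrow> bool) set set" where
  "closed_null_ideal =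
     sigma_ideal_generated UNIV {C. closed C \<and> C \<in> null_sets cantor_measure}"

section \<open>Hausdorff measures\<close>

text \<open>Metric spaces are given by a carrier \<open>X\<close> and a distance function \<open>d\<close>, as in \<^locale>\<open>Metric_space\<close>.\<close>

definition ediam :: "('a \<Rightarrow> 'a \<Rightarrow> real) \<Rightarrow> 'a set \<Rightarrow> ennreal" where
  "ediam d C = (SUP x\<in>C. SUP y\<in>C. ennreal (d x y))"

text \<open>
  The sets of a \<open>\<delta>\<close>-cover have finite diameter, so \<^const>\<open>enn2real\<close> loses no information below.
\<close>

definition hausdorff_pre ::
  "'a set \<Rightarrow> ('a \<Rightarrow> 'a \<Rightarrow> real) \<Rightarrow> (real \<Rightarrow> real) \<Rightarrow> real \<Rightarrow> 'a set \<Rightarrow> ennreal" where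
  "hausdorff_pre X d f \<delta> A =
     (INF C \<in> {C :: nat \<Rightarrow> 'a set. (\<forall>n. C n \<subseteq> X) \<and> A \<subseteq> (\<Union>n. C n) \<and>
                                   (\<forall>n. ediam d (C n) \<le> ennreal \<delta>)}.
        \<Sum>n. ennreal (f (enn2real (ediam d (C n)))))"

definition hausdorff_measure ::
  "'a set \<Rightarrow> ('a \<Rightarrow> 'a \<Rightarrow> real) \<Rightarrow> (real \<Rightarrow> real) \<Rightarrow> 'a set \<Rightarrow> ennreal" where
  "hausdorff_measure X d f A = (SUP \<delta>\<in>{0<..}. hausdorff_pre X d f \<delta> A)"

definition hausdorff_null ::
  "'a set \<Rightarrow> ('a \<Rightarrow> 'a \<Rightarrow> real) \<Rightarrow> (real \<Rightarrow> real) \<Rightarrow> 'a set set" where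
  "hausdorff_null X d f = {A. A \<subseteq> X \<and> hausdorff_measure X d f A = 0}"

section \<open>The Davies--Rogers space\<close>

text \<open>Finite simple graphs are represented by \<^locale>\<open>pair_graph\<close>: each edge is a pair of opposite arcs.\<close>

definition indep_set :: "'v pair_pre_digraph \<Rightarrow> 'v set \<Rightarrow> bool" where
  "indep_set G H \<longleftrightarrow> H \<subseteq> pverts G \<and> (\<forall>u\<in>H. \<forall>v\<in>H. (u, v) \<notin> parcs G)"

definition davies_rogers_graph :: "nat \<Rightarrow> 'v pair_pre_digraph \<Rightarrow> bool" where
  "davies_rogers_graph n G \<longleftrightarrow> pair_graph G \<and>
     \<not> (\<exists>P :: nat \<Rightarrow> 'v set. (\<forall>i<n. indep_set G (P i)) \<and> disjoint_family_on P {..<n} \<and>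
          (\<Union>i<n. P i) = pverts G) \<and>
     (\<forall>w :: 'v \<Rightarrow> real. (\<forall>g\<in>pverts G. 0 \<le> w g) \<longrightarrow>
        (\<exists>H. indep_set G H \<and> (\<Sum>g\<in>H. w g) \<ge> 1/4 * (\<Sum>g\<in>pverts G. w g))) \<and>
     (\<exists>H :: 'v \<Rightarrow> 'v set. (\<forall>x\<in>pverts G. indep_set G (H x) \<and> x \<in> H x) \<and>
        (\<forall>a\<in>pverts G. real (card {x \<in> pverts G. a \<in> H x}) \<ge> 1/4 * real (card (pverts G))))"

text \<open>
  Throughout, \<open>G n\<close> is the graph chosen for the integer \<open>n > 0\<close>; the value of \<open>G\<close> at \<open>0\<close> is
  never used. The numbers \<open>M\<^sub>n\<close> and the graphs \<open>G\<^sub>n = G(M\<^sub>n)\<close> depend on this choice.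
\<close>

primrec dr_M :: "(nat \<Rightarrow> 'v pair_pre_digraph) \<Rightarrow> nat \<Rightarrow> nat" where
  "dr_M G 0 = 1"
| "dr_M G (Suc n) = 2 * card (pverts (G (dr_M G n)))"

definition dr_graph :: "(nat \<Rightarrow> 'v pair_pre_digraph) \<Rightarrow> nat \<Rightarrow> 'v pair_pre_digraph" where
  "dr_graph G n = G (dr_M G n)"

definition dr_space :: "(nat \<Rightarrow> 'v pair_pre_digraph) \<Rightarrow> (nat \<Rightarrow> 'v) set" where
  "dr_space G = (\<Pi> n\<in>UNIV. pverts (dr_graph G n))"

definition dr_dist :: "(nat \<Rightarrow> 'v pair_pre_digraph) \<Rightarrow> (nat \<Rightarrow> 'v) \<Rightarrow> (nat \<Rightarrow> 'v) \<Rightarrow> real" where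
  "dr_dist G x y =
     (if x = y then 0
      else let n = (LEAST n. x n \<noteq> y n)
           in if (x n, y n) \<in> parcs (dr_graph G n) then 2 powi (1 - int n) else 2 powi (- int n))"

definition dr_gauge_value :: "(nat \<Rightarrow> 'v pair_pre_digraph) \<Rightarrow> nat \<Rightarrow> real" where
  "dr_gauge_value G n = 1 / (\<Prod>i\<le>n. real (dr_M G i))"

text \<open>
  For \<open>0 < t \<le> 1\<close> the index \<open>n\<close> below is the one with \<open>2\<^bsup>-(n+1)\<^esup> < t \<le> 2\<^bsup>-n\<^esup>\<close>.
\<close>

definition dr_gauge :: "(nat \<Rightarrow> 'v pair_pre_digraph) \<Rightarrow> real \<Rightarrow> real" where
  "dr_gauge G t =
     (if t \<le> 0 then 0
      else if t > 1 then 1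
      else let n = (LEAST n. (1/2) ^ Suc n < t);
               a = (1/2) ^ Suc n; b = (1/2) ^ n
           in dr_gauge_value G (Suc n) +
              (t - a) / (b - a) * (dr_gauge_value G n - dr_gauge_value G (Suc n)))"

definition dr_null :: "(nat \<Rightarrow> 'v pair_pre_digraph) \<Rightarrow> (nat \<Rightarrow> 'v) set set" where
  "dr_null G = hausdorff_null (dr_space G) (dr_dist G) (dr_gauge G)"

lemma dr_gauge_dyadic: "dr_gauge G ((1/2) ^ n) = dr_gauge_value G n"
proof -
  have least: "(LEAST m. (1/2::real) ^ Suc m < (1/2) ^ n) = n"
  proof (rule Least_equality)
    fix m assume "(1/2::real) ^ Suc m < (1/2) ^ n"
    moreover have "(1/2::real) ^ n \<le> (1/2) ^ Suc m" if "Suc m \<le> n"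
      using that by (rule power_decreasing) auto
    ultimately show "n \<le> m" by (meson not_less not_less_eq_eq)
  qed simp
  have not_le: "\<not> (1/2::real) ^ n \<le> 0" "\<not> (1/2::real) ^ n > 1"
    by (simp_all add: not_le not_less power_le_one)
  show ?thesis
    unfolding dr_gauge_def Let_def if_not_P[OF not_le(1)] if_not_P[OF not_le(2)] least by simp
qed

lemma Metric_space_dr:
  assumes "\<And>n. n > 0 \<Longrightarrow> davies_rogers_graph n (G n)"
  shows "Metric_space (dr_space G) (dr_dist G)"
proof -
  have pos: "dr_M G n > 0 \<and> pair_graph (dr_graph G n)" for n
  proof (induction n)
    case 0
    show ?case using assms[of 1] by (simp add: dr_graph_def davies_rogers_graph_def)
  next
    case (Suc n)
    let ?g = "G (dr_M G n)"
    have dr: "davies_rogers_graph (dr_M G n) ?g" using assms Suc by blast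
    have "pverts ?g \<noteq> {}"
    proof
      assume "pverts ?g = {}"
      hence "(\<forall>i<dr_M G n. indep_set ?g {}) \<and> disjoint_family_on (\<lambda>_. {}) {..<dr_M G n} \<and>
          (\<Union>i<dr_M G n. {}) = pverts ?g"
        by (simp add: indep_set_def disjoint_family_on_def)
      hence "\<exists>P :: nat \<Rightarrow> 'a set. (\<forall>i<dr_M G n. indep_set ?g (P i)) \<and>
          disjoint_family_on P {..<dr_M G n} \<and> (\<Union>i<dr_M G n. P i) = pverts ?g"
        by (rule exI[of _ "\<lambda>_. {}"])
      thus False using dr by (simp add: davies_rogers_graph_def)
    qed
    moreover have "finite (pverts ?g)"
      using dr by (auto simp: davies_rogers_graph_def pair_graph_def pair_digraph_def
          pair_fin_digraph_def pair_fin_digraph_axioms_def)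
    ultimately have "dr_M G (Suc n) > 0" by (simp add: card_gt_0_iff)
    moreover from this have "davies_rogers_graph (dr_M G (Suc n)) (dr_graph G (Suc n))"
      unfolding dr_graph_def by (rule assms)
    ultimately show ?case by (simp add: davies_rogers_graph_def del: dr_M.simps)
  qed
  have sym: "(u, v) \<in> parcs (dr_graph G n) \<longleftrightarrow> (v, u) \<in> parcs (dr_graph G n)" for u v n
  proof -
    have "pair_sym_digraph (dr_graph G n)"
      using pos[of n] by (simp add: pair_graph_def pair_pseudo_graph_def)
    hence "sym (parcs (dr_graph G n))"
      by (simp add: pair_sym_digraph_def pair_sym_digraph_axioms_def symmetric_def)
    thus ?thesis by (meson symD)
  qed
  have Least_ne: "x (LEAST n. x n \<noteq> y n) \<noteq> y (LEAST n. x n \<noteq> y n)" if "x \<noteq> y"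
    for x y :: "nat \<Rightarrow> 'a" using that LeastI_ex[of "\<lambda>n. x n \<noteq> y n"] by (simp add: fun_eq_iff)
  have Least_lt: "x m = y m" if "m < (LEAST n. x n \<noteq> y n)" for x y :: "nat \<Rightarrow> 'a" and m
    using not_less_Least[OF that] by simp
  have dval: "dr_dist G x y = (if (x n, y n) \<in> parcs (dr_graph G n)
       then 2 powi (1 - int n) else 2 powi (- int n))"
    if "x n \<noteq> y n" "\<And>m. m < n \<Longrightarrow> x m = y m" for x y n
  proof -
    have "(LEAST n. x n \<noteq> y n) = n"
      using that by (intro Least_equality) (auto simp: not_less[symmetric])
    thus ?thesis using that(1) by (auto simp: dr_dist_def Let_def)
  qed
  have nonneg: "dr_dist G x y \<ge> 0" for x y by (simp add: dr_dist_def Let_def)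
  have pow: "(2::real) powi (1 - int n) = 2 * 2 powi (- int n)" for n
    by (simp add: power_int_diff power_int_minus field_simps)
  have comm: "dr_dist G x y = dr_dist G y x" for x y
  proof -
    have "(LEAST n. x n \<noteq> y n) = (LEAST n. y n \<noteq> x n)" by (simp add: eq_commute[of "x _"])
    thus ?thesis using sym by (auto simp: dr_dist_def Let_def)
  qed
  have ge: "dr_dist G x y \<ge> 2 powi (- int n)" if "x n \<noteq> y n" for x y n
  proof -
    define k where "k = (LEAST n. x n \<noteq> y n)"
    have "x k \<noteq> y k" unfolding k_def by (rule Least_ne) (use that in blast)
    moreover have "x m = y m" if "m < k" for m
      using that unfolding k_def by (rule Least_lt)
    ultimately have "dr_dist G x y \<ge> 2 powi (- int k)"
      by (subst dval[of x k y]) (simp_all add: pow)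
    moreover have "k \<le> n" unfolding k_def by (rule Least_le) (rule that)
    hence "(2::real) powi (- int k) \<ge> 2 powi (- int n)" by (intro power_int_increasing) auto
    ultimately show ?thesis by linarith
  qed
  have tri: "dr_dist G x z \<le> dr_dist G x y + dr_dist G y z" for x y z
  proof (cases "x = z")
    case True thus ?thesis using nonneg[of x y] nonneg[of y z] by (simp add: dr_dist_def)
  next
    case False
    define n where "n = (LEAST n. x n \<noteq> z n)"
    have n: "x n \<noteq> z n" "\<And>m. m < n \<Longrightarrow> x m = z m"
      unfolding n_def by (rule Least_ne[OF False], rule Least_lt)
    have le: "dr_dist G x z \<le> 2 * 2 powi (- int n)"
      by (subst dval[of x n z, OF n]) (simp_all add: pow)
    show ?thesis
    proof (cases "\<forall>m<n. y m = x m")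
      case eq: True
      consider "y n = x n" | "y n = z n" | "y n \<noteq> x n" "y n \<noteq> z n" by blast
      thus ?thesis
      proof cases
        case 1
        have "dr_dist G y z = dr_dist G x z"
          using dval[of x n z, OF n] dval[of y n z] 1 n eq by simp
        thus ?thesis using nonneg[of x y] by linarith
      next
        case 2
        have "dr_dist G x y = dr_dist G x z"
          using dval[of x n z, OF n] dval[of x n y] 2 n(1) eq by simp
        thus ?thesis using nonneg[of y z] by linarith
      next
        case 3
        thus ?thesis using le ge[of x n y, OF 3(1)[symmetric]] ge[of y n z, OF 3(2)] by linarith
      qed
    next
      case False
      then obtain m where m: "m < n" "y m \<noteq> x m" by blast
      have "dr_dist G x y \<ge> 2 powi (- int m)" "dr_dist G y z \<ge> 2 powi (- int m)"
        using ge[of x m y] ge[of y m z] m(2) n(2)[OF m(1)] by simp_all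
      moreover have "(2::real) powi (- int m) \<ge> 2 powi (- int n)"
        using m by (intro power_int_increasing) auto
      ultimately show ?thesis using le by linarith
    qed
  qed
  have zero: "dr_dist G x y = 0 \<longleftrightarrow> x = y" for x y by (simp add: dr_dist_def Let_def)
  show ?thesis
    by (rule Metric_space.intro) (rule nonneg comm zero tri)+
qed

end

theory Submission
  imports Defs
begin

text \<open>
  Both inequalities follow from a relation \<open>R \<subseteq> \<Omega> \<times> 2\<^sup>\<omega>\<close> such that every \<open>{x. R x z}\<close> is \<open>h\<close>-null
  and every \<open>{z. \<not> R x z}\<close> lies in the ideal of the Cantor space. With the independent sets
  \<open>H\<^sub>n(g)\<close> of property (3), decode the \<open>n\<close>-th block of bits of \<open>z\<close> to a vertex \<open>z\<^sub>n\<close> of \<open>G\<^sub>n\<close> and let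
  \<open>R x z\<close> say that \<open>x(n) \<in> H\<^sub>n(z\<^sub>n)\<close> for infinitely many \<open>n\<close>. Fixing the first \<open>n\<close> coordinates of \<open>x\<close>
  and restricting \<open>x(n)\<close> to an independent set gives a set of diameter \<open>2\<^sup>-\<^sup>n\<close>, and there are
  \<open>N\<^sub>0 \<dots> N\<^sub>n\<^sub>-\<^sub>1 = 2\<^sup>-\<^sup>n M\<^sub>0 \<dots> M\<^sub>n\<close> prefixes, so the condition at \<open>n\<close> costs only \<open>2\<^sup>-\<^sup>n\<close>. For fixed \<open>x\<close> the
  blocks are independent and each fails with probability at most \<open>7/8\<close>.

  Since \<^const>\<open>non\<close> is junk for an improper ideal, one also needs that \<open>\<Omega>\<close> is not \<open>h\<close>-null; this is
  where property (1) of the graphs enters.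
\<close>

section \<open>Covering and uniformity numbers\<close>

lemma min_card_le: "A \<in> \<A> \<Longrightarrow> min_card \<A> \<le>o |A|"
proof -
  assume A: "A \<in> \<A>"
  hence "\<A> \<noteq> {}" by blast
  thus ?thesis
  proof (rule min_card_attained)
    fix B assume "min_card \<A> = |B|" "\<And>C. C \<in> \<A> \<Longrightarrow> |B| \<le>o |C|"
    thus ?thesis using A by simp
  qed
qed

text \<open>A set \<open>A\<close> outside \<open>J\<close> of least size indexes a cover of
  \<open>X\<close>: if \<open>x\<close> were in no section \<open>{x. R x y}\<close> with
  \<open>y \<in> A\<close>, then \<open>A\<close> would lie inside \<open>{y. \<not> R x y}\<close>,
  which is in \<open>J\<close>. The hypothesis \<open>Y \<notin> J\<close> makes
  \<open>non Y J\<close> an attained minimum.\<close>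

lemma cov_le_non:
  assumes I: "\<And>y. y \<in> Y \<Longrightarrow> {x \<in> X. R x y} \<in> I"
    and J: "\<And>x. x \<in> X \<Longrightarrow> {y \<in> Y. \<not> R x y} \<in> J" "\<And>A B. A \<in> J \<Longrightarrow> B \<subseteq> A \<Longrightarrow> B \<in> J" "Y \<notin> J"
  shows "cov X I \<le>o non Y J"
proof -
  let ?\<A> = "{A. A \<subseteq> Y \<and> A \<notin> J}"
  from J(3) have "?\<A> \<noteq> {}" by blast
  hence "\<exists>A. A \<in> ?\<A> \<and> min_card ?\<A> = |A|" by (rule min_card_attained) (intro exI conjI)
  then obtain A where A: "A \<subseteq> Y" "A \<notin> J" "non Y J = |A|" by (auto simp: non_def)
  let ?F = "(\<lambda>y. {x \<in> X. R x y}) ` A"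
  have "\<exists>y\<in>A. R x y" if "x \<in> X" for x
  proof (rule ccontr)
    assume "\<not> (\<exists>y\<in>A. R x y)"
    hence "A \<subseteq> {y \<in> Y. \<not> R x y}" using A(1) by blast
    thus False using A(2) J(1)[OF that] J(2) by blast
  qed
  hence "?F \<in> {F. F \<subseteq> I \<and> \<Union>F = X}" using A(1) I by auto
  hence "cov X I \<le>o |?F|" unfolding cov_def by (rule min_card_le)
  also have "|?F| \<le>o |A|" by (rule card_of_image)
  finally show ?thesis by (simp add: A)
qed

section \<open>Blocks of bits in the Cantor space\<close>

interpretation bits: product_prob_space "\<lambda>_::nat. measure_pmf (bernoulli_pmf (1/2))" UNIV
  by unfold_locales

interpretation cantor: prob_space cantor_measure
  unfolding cantor_measure_def by unfold_locales

lemma space_cantor_measure [simp]: "space cantor_measure = UNIV"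
  by (simp add: cantor_measure_def space_PiM)

lemma sets_PiM_bernoulli:
  "finite J \<Longrightarrow> sets (\<Pi>\<^sub>M i\<in>J. measure_pmf (bernoulli_pmf (1/2))) = Pow (J \<rightarrow>\<^sub>E UNIV)" for J :: "nat set"
proof -
  assume J: "finite J"
  have "sets (\<Pi>\<^sub>M i\<in>J. measure_pmf (bernoulli_pmf (1/2))) = sets (\<Pi>\<^sub>M i\<in>J. count_space UNIV)"
    by (intro sets_PiM_cong) auto
  thus ?thesis by (simp add: count_space_PiM_finite J)
qed

lemma measurable_restrict_cantor:
  "(\<lambda>z. restrict z J) \<in> cantor_measure \<rightarrow>\<^sub>M (\<Pi>\<^sub>M i\<in>J. measure_pmf (bernoulli_pmf (1/2)))"
  unfolding cantor_measure_def by (intro measurable_restrict_subset) auto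

lemma sets_cantor_restrict:
  assumes "finite J"
  shows "{z. restrict z J \<in> T} \<in> sets cantor_measure"
proof -
  have "(\<lambda>z. restrict z J) -` (T \<inter> (J \<rightarrow>\<^sub>E UNIV)) \<inter> space cantor_measure \<in> sets cantor_measure"
    by (rule measurable_sets[OF measurable_restrict_cantor]) (simp add: sets_PiM_bernoulli assms)
  also have "(\<lambda>z. restrict z J) -` (T \<inter> (J \<rightarrow>\<^sub>E UNIV)) \<inter> space cantor_measure = {z. restrict z J \<in> T}"
    by auto
  finally show ?thesis .
qed

lemma measure_cantor_restrict_singleton:
  assumes "finite J" "s \<in> J \<rightarrow>\<^sub>E UNIV"
  shows "measure cantor_measure {z. restrict z J = s} = (1/2) ^ card J"
proof -
  have "{z. restrict z J = s} = bits.emb UNIV J (\<Pi>\<^sub>E i\<in>J. {s i})"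
    using assms(2)
    by (auto simp: prod_emb_def fun_eq_iff PiE_iff restrict_def extensional_def)
  also have "measure cantor_measure \<dots> =
      (\<Prod>i\<in>J. measure (measure_pmf (bernoulli_pmf (1/2))) {s i})"
    unfolding cantor_measure_def by (rule bits.measure_PiM_emb) (use assms in auto)
  also have "\<dots> = (\<Prod>i\<in>J. 1/2)"
    by (intro prod.cong refl) (simp add: measure_pmf_single pmf_bernoulli_half)
  finally show ?thesis by simp
qed

lemma measure_cantor_restrict:
  assumes "finite J" "T \<subseteq> J \<rightarrow>\<^sub>E UNIV"
  shows "measure cantor_measure {z. restrict z J \<in> T} = real (card T) / 2 ^ card J"
proof -
  have fin: "finite T"
    by (rule finite_subset[OF assms(2)]) (simp add: finite_PiE assms)
  have "{z. restrict z J \<in> T} = (\<Union>s\<in>T. {z. restrict z J = s})" by auto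
  also have "measure cantor_measure \<dots> = (\<Sum>s\<in>T. measure cantor_measure {z. restrict z J = s})"
    using sets_cantor_restrict[OF assms(1), of "{s}" for s]
    by (intro cantor.finite_measure_finite_Union fin) (auto simp: disjoint_family_on_def)
  also have "\<dots> = (\<Sum>s\<in>T. (1/2) ^ card J)"
    using assms by (intro sum.cong refl measure_cantor_restrict_singleton) auto
  finally show ?thesis by (simp add: power_one_over field_simps)
qed

text \<open>Finitely many patterns live on \<open>J\<close>, so this is a finite union of sets that
  fix finitely many coordinates.\<close>

lemma closed_cantor_restrict:
  assumes "finite J"
  shows "closed {z :: nat \<Rightarrow> bool. restrict z J \<in> T}"
proof -
  have restrict_eq: "restrict z J = s" if "s \<in> J \<rightarrow>\<^sub>E UNIV" "\<And>i. i \<in> J \<Longrightarrow> z i = s i" for z s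
    using that by (auto simp: fun_eq_iff restrict_def PiE_iff extensional_def)
  have eq: "{z. restrict z J \<in> T} = (\<Union>s\<in>T \<inter> (J \<rightarrow>\<^sub>E UNIV). \<Inter>i\<in>J. {z. z i = s i})"
  proof (intro set_eqI iffI)
    fix z assume "z \<in> {z. restrict z J \<in> T}"
    thus "z \<in> (\<Union>s\<in>T \<inter> (J \<rightarrow>\<^sub>E UNIV). \<Inter>i\<in>J. {z. z i = s i})"
      by (intro UN_I[of "restrict z J"]) auto
  next
    fix z assume "z \<in> (\<Union>s\<in>T \<inter> (J \<rightarrow>\<^sub>E UNIV). \<Inter>i\<in>J. {z. z i = s i})"
    then obtain s where "s \<in> T" "s \<in> J \<rightarrow>\<^sub>E UNIV" "\<And>i. i \<in> J \<Longrightarrow> z i = s i" by auto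
    thus "z \<in> {z. restrict z J \<in> T}" using restrict_eq[of s z] by simp
  qed
  have "finite (T \<inter> (J \<rightarrow>\<^sub>E UNIV))" using assms by (simp add: finite_PiE)
  thus ?thesis unfolding eq
    by (intro closed_UN closed_INT ballI closed_Collect_eq) auto
qed

text \<open>Coordinates are independent under a product measure, and grouping them along disjoint
  index sets preserves this.\<close>

lemma indep_vars_cantor_blocks:
  assumes "disjoint_family J"
  shows "cantor.indep_vars (\<lambda>n. \<Pi>\<^sub>M i\<in>J n. measure_pmf (bernoulli_pmf (1/2)))
           (\<lambda>n z. restrict z (J n)) UNIV"
proof -
  have "cantor.indep_vars (\<lambda>_. measure_pmf (bernoulli_pmf (1/2))) (\<lambda>i z. z i) UNIV"
  proof (subst cantor.indep_vars_iff_distr_eq_PiM)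
    show "distr cantor_measure (\<Pi>\<^sub>M i\<in>UNIV. measure_pmf (bernoulli_pmf (1/2))) (\<lambda>x. \<lambda>i\<in>UNIV. x i) =
      (\<Pi>\<^sub>M i\<in>UNIV. distr cantor_measure (measure_pmf (bernoulli_pmf (1/2))) (\<lambda>x. x i))"
      unfolding cantor_measure_def
      by (simp add: bits.PiM_component distr_id2 restrict_def)
  qed (auto simp: cantor_measure_def)
  from cantor.indep_vars_restrict[OF this _ assms] show ?thesis by simp
qed

section \<open>The ideal generated by the closed null sets\<close>

lemma sigma_ideal_generated_UN:
  assumes "\<And>n::nat. A n \<in> K"
  shows "(\<Union>n. A n) \<in> sigma_ideal_generated X K"
  unfolding sigma_ideal_generated_def
proof (intro InterI, elim CollectE conjE)
  fix I assume I: "sigma_ideal X I" "K \<subseteq> I"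
  hence "range A \<subseteq> I" using assms by auto
  thus "(\<Union>n. A n) \<in> I" using I(1) by (simp add: sigma_ideal_def)
qed

lemma sigma_ideal_generated_subset:
  assumes "A \<in> sigma_ideal_generated X K" "B \<subseteq> A"
  shows "B \<in> sigma_ideal_generated X K"
  using assms unfolding sigma_ideal_generated_def sigma_ideal_def by blast

text \<open>The set is the countable union of the closed sets \<open>E m\<close>. Each
  \<open>E m\<close> is null because it constrains infinitely many independent blocks, each with
  probability at most \<open>c < 1\<close>.\<close>

lemma closed_null_ideal_blocks:
  fixes J :: "nat \<Rightarrow> nat set"
  assumes J: "disjoint_family J" "\<And>n. finite (J n)" and "c < 1"
    and le: "\<And>n. measure cantor_measure {z. restrict z (J n) \<in> T n} \<le> c"
  shows "{z. eventually (\<lambda>n. restrict z (J n) \<in> T n) sequentially} \<in> closed_null_ideal"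
proof -
  define E where "E m = {z. \<forall>n\<ge>m. restrict z (J n) \<in> T n}" for m
  have E_eq: "E m = (\<Inter>n\<in>{m..}. {z. restrict z (J n) \<in> T n})" for m by (auto simp: E_def)
  have closed: "closed (E m)" for m
    unfolding E_eq by (intro closed_INT ballI closed_cantor_restrict J)
  have sets: "E m \<in> sets cantor_measure" for m
    unfolding E_eq by (intro sets.countable_INT' sets_cantor_restrict J) (auto intro!: sets_cantor_restrict J)
  have c: "0 \<le> c" using le[of 0] measure_nonneg[of cantor_measure] by (rule order_trans[rotated])
  have bound: "measure cantor_measure (E m) \<le> c ^ Suc k" for m k
  proof -
    \<comment> \<open>The window has \<open>Suc k\<close> blocks, whence the exponent. Independence
      needs measurable sets of patterns, so \<open>T n\<close> is cut down; the preimages do not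
      change.\<close>
    let ?K = "{m..m+k}" and ?T = "\<lambda>n. T n \<inter> (J n \<rightarrow>\<^sub>E UNIV)"
    have pre: "(\<lambda>z. restrict z (J n)) -` ?T n \<inter> space cantor_measure = {z. restrict z (J n) \<in> T n}" for n
      by auto
    have "measure cantor_measure (E m) \<le>
        measure cantor_measure (\<Inter>n\<in>?K. (\<lambda>z. restrict z (J n)) -` ?T n \<inter> space cantor_measure)"
      unfolding pre
      by (rule cantor.finite_measure_mono)
        (auto simp: E_def intro!: sets.finite_INT sets_cantor_restrict J)
    also have "\<dots> = (\<Prod>n\<in>?K. measure cantor_measure ((\<lambda>z. restrict z (J n)) -` ?T n \<inter> space cantor_measure))"
      by (rule cantor.indep_varsD[OF indep_vars_cantor_blocks[OF J(1)]])
        (auto simp: sets_PiM_bernoulli J)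
    also have "\<dots> \<le> (\<Prod>n\<in>?K. c)"
      unfolding pre using le by (intro prod_mono) auto
    finally show ?thesis by simp
  qed
  have "(\<lambda>k. c ^ Suc k) \<longlonglongrightarrow> 0" using c \<open>c < 1\<close> by (intro LIMSEQ_Suc LIMSEQ_power_zero) auto
  hence "measure cantor_measure (E m) \<le> 0" for m
    by (rule tendsto_lowerbound) (auto intro!: always_eventually bound simp del: power_Suc)
  hence "E m \<in> null_sets cantor_measure" for m
    using sets by (auto simp: null_sets_def cantor.emeasure_eq_measure measure_le_0_iff)
  moreover have "{z. eventually (\<lambda>n. restrict z (J n) \<in> T n) sequentially} = (\<Union>m. E m)"
    by (auto simp: E_def eventually_sequentially)
  ultimately show ?thesis using closed
    by (auto simp: closed_null_ideal_def intro!: sigma_ideal_generated_UN)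
qed

lemma UNIV_notin_closed_null_ideal: "UNIV \<notin> closed_null_ideal"
proof
  \<comment> \<open>All subsets of null sets form a sigma-ideal containing the generators; it omits
    the whole space, which has measure 1.\<close>
  let ?I = "{A. \<exists>N\<in>null_sets cantor_measure. A \<subseteq> N}"
  assume "UNIV \<in> closed_null_ideal"
  moreover have "sigma_ideal UNIV ?I"
  proof -
    have "(\<Union>n. A n) \<in> ?I" if "range A \<subseteq> ?I" for A :: "nat \<Rightarrow> _"
    proof -
      have "\<forall>n. \<exists>N\<in>null_sets cantor_measure. A n \<subseteq> N" using that by auto
      then obtain N where "\<And>n. N n \<in> null_sets cantor_measure" "\<And>n. A n \<subseteq> N n" by metis
      thus ?thesis by (auto intro!: bexI[of _ "\<Union>n. N n"])
    qed
    thus ?thesis unfolding sigma_ideal_def by blast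
  qed
  ultimately have "UNIV \<in> ?I"
    unfolding closed_null_ideal_def sigma_ideal_generated_def by blast
  hence "space cantor_measure \<in> null_sets cantor_measure" by (auto simp: top.extremum_unique)
  thus False using cantor.emeasure_space_1 by (simp add: null_sets_def)
qed

text \<open>
  Coding by \<open>k\<close> bits with \<open>card A \<le> 2\<^sup>k < 2 card A\<close> at most halves the density of a subset of \<open>A\<close>.
\<close>

lemma ex_bit_coding:
  fixes A :: "'a set" and H :: "'a \<Rightarrow> 'b set"
  assumes A: "finite A" "A \<noteq> {}"
    and H: "\<And>a. a \<in> B \<Longrightarrow> real (card {x \<in> A. a \<in> H x}) \<ge> 1/4 * real (card A)"
  shows "\<exists>k. \<forall>J::nat set. finite J \<longrightarrow> card J = k \<longrightarrow>
    (\<exists>f. (\<forall>s. f s \<in> A) \<and>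
      (\<forall>a\<in>B. real (card {s \<in> J \<rightarrow>\<^sub>E (UNIV::bool set). a \<notin> H (f s)}) \<le> 7/8 * 2 ^ card J))"
proof -
  have "\<exists>k. card A \<le> 2 ^ k" by (intro exI[of _ "card A"]) simp
  then obtain k where k: "card A \<le> 2 ^ k" "\<And>j. j < k \<Longrightarrow> \<not> card A \<le> 2 ^ j"
    using exists_least_iff[of "\<lambda>k. card A \<le> 2 ^ k"] by blast
  have k2: "2 ^ k < 2 * card A"
  proof (cases k)
    case 0
    have "card A > 0" using A by (simp add: card_gt_0_iff)
    thus ?thesis using 0 by simp
  next
    case (Suc j) thus ?thesis using k(2)[of j] by simp
  qed
  show ?thesis
  proof (intro exI[of _ k] allI impI)
    fix J :: "nat set" assume J: "finite J" "card J = k"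
    let ?P = "J \<rightarrow>\<^sub>E (UNIV :: bool set)"
    have P: "finite ?P" "card ?P = 2 ^ k" using J by (auto simp: finite_PiE card_PiE)
    obtain g where g: "g ` A \<subseteq> ?P" "inj_on g A"
      using card_le_inj[OF A(1) P(1)] k(1) P(2) by auto
    obtain a0 where a0: "a0 \<in> A" using A(2) by blast
    \<comment> \<open>\<open>f\<close> inverts the coding \<open>g\<close>; patterns outside the
      image of \<open>g\<close> decode to the default \<open>a0\<close>.\<close>
    define f where "f s = (if s \<in> g ` A then inv_into A g s else a0)" for s
    have fA: "f s \<in> A" for s using a0 by (auto simp: f_def inv_into_into)
    have fg: "f (g x) = x" if "x \<in> A" for x using that g(2) by (simp add: f_def)
    have "real (card {s \<in> ?P. a \<notin> H (f s)}) \<le> 7/8 * 2 ^ card J" if a: "a \<in> B" for a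
    proof -
      have "card {s \<in> ?P. a \<in> H (f s)} + card {s \<in> ?P. a \<notin> H (f s)} = card ?P"
        using P(1) by (subst card_Un_disjoint[symmetric]) (auto intro!: arg_cong[where f = card])
      hence eq: "real (card {s \<in> ?P. a \<in> H (f s)}) + real (card {s \<in> ?P. a \<notin> H (f s)}) = 2 ^ k"
        using P(2) by (simp only: of_nat_add[symmetric] of_nat_power of_nat_numeral)
      \<comment> \<open>Distinct elements have distinct codes, so at least
        \<open>card A / 4 > 2 ^ k / 8\<close> patterns are good, which leaves at most 7/8 bad
        ones.\<close>
      have "card {x \<in> A. a \<in> H x} \<le> card {s \<in> ?P. a \<in> H (f s)}"
      proof (rule card_inj_on_le)
        show "inj_on g {x \<in> A. a \<in> H x}" using g(2) by (rule inj_on_subset) auto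
        show "g ` {x \<in> A. a \<in> H x} \<subseteq> {s \<in> ?P. a \<in> H (f s)}" using g(1) fg by auto
        show "finite {s \<in> ?P. a \<in> H (f s)}" using P(1) by simp
      qed
      moreover have "real (2 ^ k) < real (2 * card A)" using k2 by (simp only: of_nat_less_iff)
      ultimately show ?thesis using eq H[OF a] J(2) by simp
    qed
    thus "\<exists>f. (\<forall>s. f s \<in> A) \<and>
        (\<forall>a\<in>B. real (card {s \<in> ?P. a \<notin> H (f s)}) \<le> 7/8 * 2 ^ card J)"
      using fA by blast
  qed
qed

section \<open>The Davies--Rogers space\<close>

lemma ediam_le_iff: "ediam d C \<le> e \<longleftrightarrow> (\<forall>x\<in>C. \<forall>y\<in>C. ennreal (d x y) \<le> e)"
  by (simp add: ediam_def SUP_le_iff)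

lemma le_ediam: "x \<in> C \<Longrightarrow> y \<in> C \<Longrightarrow> ennreal (d x y) \<le> ediam d C"
  using ediam_le_iff[of d C "ediam d C"] by blast

lemma ediam_empty [simp]: "ediam d {} = 0"
  by (simp add: ediam_def bot_ennreal)

lemma hausdorff_null_subset:
  assumes "A \<in> hausdorff_null X d f" "B \<subseteq> A"
  shows "B \<in> hausdorff_null X d f"
proof -
  have "hausdorff_pre X d f \<delta> B \<le> hausdorff_pre X d f \<delta> A" for \<delta>
    unfolding hausdorff_pre_def using assms(2) by (intro INF_superset_mono) auto
  hence "hausdorff_measure X d f B \<le> hausdorff_measure X d f A"
    unfolding hausdorff_measure_def by (intro SUP_mono) blast
  thus ?thesis using assms by (auto simp: hausdorff_null_def)
qed

text \<open>Property (1) for covers instead of partitions: subsets of independent sets are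
  independent, so a cover can be made disjoint and padded with empty sets.\<close>

lemma card_indep_cover:
  assumes G: "davies_rogers_graph n G" and "finite \<H>" "\<And>H. H \<in> \<H> \<Longrightarrow> indep_set G H"
    and cover: "pverts G \<subseteq> \<Union>\<H>"
  shows "n < card \<H>"
proof (rule ccontr)
  assume "\<not> n < card \<H>"
  hence le: "card \<H> \<le> n" by simp
  obtain f where f: "bij_betw f {0..<card \<H>} \<H>" using ex_bij_betw_nat_finite[OF assms(2)] by blast
  define f' where "f' i = (if i < card \<H> then f i else {})" for i
  have f'_indep: "indep_set G (f' i)" for i
    using assms(3)[of "f i"] bij_betwE[OF f] by (auto simp: f'_def indep_set_def)
  have indep: "indep_set G (disjointed f' i)" for i
    using f'_indep[of i] disjointed_subset[of f' i] unfolding indep_set_def by blast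
  have empty: "disjointed f' i = {}" if "\<not> i < n" for i
  proof -
    have "f' i = {}" using that le by (simp add: f'_def)
    thus ?thesis using disjointed_subset[of f' i] by blast
  qed
  have "(\<Union>i<n. disjointed f' i) = (\<Union>i. disjointed f' i)"
  proof (intro equalityI subsetI)
    fix x assume "x \<in> (\<Union>i. disjointed f' i)"
    then obtain i where "x \<in> disjointed f' i" by blast
    thus "x \<in> (\<Union>i<n. disjointed f' i)" using empty[of i] by (cases "i < n") auto
  qed auto
  also have "\<dots> = (\<Union>i. f' i)" by (rule UN_disjointed_eq)
  also have "\<dots> = \<Union>\<H>"
    by (subst bij_betw_imp_surj_on[OF f, symmetric]) (auto simp: f'_def split: if_splits)
  also have "\<dots> = pverts G"
    using cover assms(3) unfolding indep_set_def by (intro equalityI Union_least) blast+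
  finally have "(\<Union>i<n. disjointed f' i) = pverts G" .
  moreover have "disjoint_family_on (disjointed f') {..<n}"
    using disjoint_family_disjointed[of f'] by (rule disjoint_family_on_mono[rotated]) simp
  ultimately show False using G indep unfolding davies_rogers_graph_def by blast
qed

section \<open>The graphs and the dyadic structure of the metric\<close>

locale davies_rogers_space =
  fixes G :: "nat \<Rightarrow> 'v pair_pre_digraph"
  assumes graphs: "\<And>n. n > 0 \<Longrightarrow> davies_rogers_graph n (G n)"
begin

abbreviation V :: "nat \<Rightarrow> 'v set" where "V n \<equiv> pverts (dr_graph G n)"
abbreviation \<Omega> :: "(nat \<Rightarrow> 'v) set" where "\<Omega> \<equiv> dr_space G"

lemma finite_nonempty_verts:
  assumes "davies_rogers_graph n H" "n > 0"
  shows "finite (pverts H)" "pverts H \<noteq> {}"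
proof -
  show "finite (pverts H)"
    using assms by (auto simp: davies_rogers_graph_def pair_graph_def pair_digraph_def
        pair_fin_digraph_def pair_fin_digraph_axioms_def)
  show "pverts H \<noteq> {}"
    using card_indep_cover[OF assms(1), of "{}"] by auto
qed

lemma M_pos: "dr_M G n > 0"
proof (induction n)
  case (Suc n)
  thus ?case using finite_nonempty_verts[OF graphs] by (simp add: card_gt_0_iff)
qed simp

lemma graph: "davies_rogers_graph (dr_M G n) (dr_graph G n)"
  unfolding dr_graph_def by (rule graphs[OF M_pos])

lemma finite_V: "finite (V n)" and V_nonempty: "V n \<noteq> {}"
  using finite_nonempty_verts[OF graph M_pos] by blast+

lemma mem_space_iff: "x \<in> \<Omega> \<longleftrightarrow> (\<forall>n. x n \<in> V n)"
  by (simp add: dr_space_def Pi_iff)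

lemma no_loop: "(u, u) \<notin> parcs (dr_graph G n)"
proof -
  have "pair_loopfree_digraph (dr_graph G n)"
    using graph[of n] by (simp add: davies_rogers_graph_def pair_graph_def pair_digraph_def)
  thus ?thesis using pair_loopfree_digraph.no_loops' by fastforce
qed

text \<open>Otherwise the vertex set itself would be a cover by one independent set, although
  \<open>dr_M G n \<ge> 1\<close>.\<close>

lemma ex_edge:
  obtains u v where "u \<in> V n" "v \<in> V n" "(u, v) \<in> parcs (dr_graph G n)"
proof -
  have "\<not> indep_set (dr_graph G n) (V n)"
    using card_indep_cover[OF graph, of "{V n}" n] M_pos[of n] by auto
  thus ?thesis using that by (auto simp: indep_set_def)
qed

lemma dist_eq:
  assumes "x n \<noteq> y n" "\<And>m. m < n \<Longrightarrow> x m = y m"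
  shows "dr_dist G x y =
    (if (x n, y n) \<in> parcs (dr_graph G n) then 2 * (1/2) ^ n else (1/2) ^ n)"
proof -
  have "(LEAST n. x n \<noteq> y n) = n"
    using assms by (intro Least_equality) (auto simp: not_less[symmetric])
  thus ?thesis using assms(1)
    by (auto simp: dr_dist_def Let_def power_int_diff power_int_minus power_one_over field_simps)
qed

lemma dist_self [simp]: "dr_dist G x x = 0"
  by (simp add: dr_dist_def)

lemma ex_least_diff:
  fixes x y :: "nat \<Rightarrow> 'v"
  assumes "x \<noteq> y"
  shows "\<exists>n. x n \<noteq> y n \<and> (\<forall>m<n. x m = y m)"
proof -
  from assms obtain k where "x k \<noteq> y k" by auto
  thus ?thesis using exists_least_iff[of "\<lambda>n. x n \<noteq> y n"] by blast
qed

text \<open>Turns diameters into combinatorics: a subset of \<open>\<Omega>\<close> has diameter at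
  most \<open>(1/2) ^ n\<close> iff its points share the first \<open>n\<close> coordinates and its
  projection to coordinate \<open>n\<close> is independent.\<close>

lemma dist_le_iff:
  "dr_dist G x y \<le> (1/2) ^ n \<longleftrightarrow> (\<forall>i<n. x i = y i) \<and> (x n, y n) \<notin> parcs (dr_graph G n)"
proof (cases "x = y")
  case True thus ?thesis using no_loop by simp
next
  case False
  then obtain k where k: "x k \<noteq> y k" "\<And>m. m < k \<Longrightarrow> x m = y m" 
    using ex_least_diff by blast
  hence d: "dr_dist G x y =
      (if (x k, y k) \<in> parcs (dr_graph G k) then 2 * (1/2) ^ k else (1/2) ^ k)"
    by (rule dist_eq)
  consider "k < n" | "k = n" | "k > n" by linarith
  thus ?thesis
  proof cases
    case 1
    have "(1/2::real) ^ n < (1/2) ^ k" using 1 by (intro power_strict_decreasing) auto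
    moreover have "(1/2) ^ k \<le> dr_dist G x y" unfolding d by simp
    ultimately have "\<not> dr_dist G x y \<le> (1/2) ^ n" by linarith
    thus ?thesis using 1 k by blast
  next
    case 2
    thus ?thesis using k d by auto
  next
    case 3
    have "(1/2::real) ^ k \<le> (1/2) ^ Suc n" using 3 by (intro power_decreasing) auto
    moreover have "dr_dist G x y \<le> 2 * (1/2) ^ k" unfolding d by simp
    ultimately have "dr_dist G x y \<le> (1/2) ^ n" by simp
    moreover have "x n = y n" using k 3 by blast
    ultimately show ?thesis using k 3 no_loop by auto
  qed
qed

lemma dist_dyadic:
  assumes "x \<noteq> y" "dr_dist G x y \<le> 1"
  shows "\<exists>n. dr_dist G x y = (1/2) ^ n"
proof -
  obtain k where k: "x k \<noteq> y k" "\<And>m. m < k \<Longrightarrow> x m = y m" 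
    using ex_least_diff[OF assms(1)] by blast
  hence d: "dr_dist G x y =
      (if (x k, y k) \<in> parcs (dr_graph G k) then 2 * (1/2) ^ k else (1/2) ^ k)"
    by (rule dist_eq)
  show ?thesis
  proof (cases "(x k, y k) \<in> parcs (dr_graph G k)")
    case True
    \<comment> \<open>An edge at coordinate 0 would give distance 2, so \<open>k > 0\<close> and the
      distance is \<open>(1/2) ^ j\<close>.\<close>
    moreover from this d assms(2) obtain j where "k = Suc j" by (cases k) auto
    ultimately show ?thesis using d by (intro exI[of _ j]) simp
  next
    case False thus ?thesis using d by auto
  qed
qed

section \<open>Values of the gauge\<close>

lemma gauge_zero [simp]: "dr_gauge G 0 = 0"
  by (simp add: dr_gauge_def)

lemma gauge_value_pos: "dr_gauge_value G n > 0"
  unfolding dr_gauge_value_def using M_pos by (simp add: prod_pos)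

text \<open>The first factor counts the prefixes of length \<open>n\<close>. It telescopes by
  \<open>M\<^sub>0 = 1\<close> and \<open>M\<^sub>i\<^sub>+\<^sub>1 = 2 N\<^sub>i\<close>; hence one
  box per prefix costs \<open>(1/2) ^ n\<close> in total.\<close>

lemma gauge_value_eq: "(\<Prod>i<n. real (card (V i))) * dr_gauge_value G n = (1/2) ^ n"
proof (induction n)
  case (Suc n)
  have N: "real (card (V n)) > 0" using finite_V V_nonempty by (simp add: card_gt_0_iff)
  have "dr_gauge_value G (Suc n) = dr_gauge_value G n / (2 * real (card (V n)))"
    by (simp add: dr_gauge_value_def dr_graph_def)
  hence "(\<Prod>i<Suc n. real (card (V i))) * dr_gauge_value G (Suc n) =
      ((\<Prod>i<n. real (card (V i))) * dr_gauge_value G n) / 2" using N by simp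
  thus ?case using Suc.IH by simp
qed (simp add: dr_gauge_value_def)

lemma gauge_value_le: "dr_gauge_value G n \<le> (1/2) ^ n"
proof -
  have "real (card (V i)) \<ge> 1" for i
    using finite_V V_nonempty by (simp add: Suc_le_eq card_gt_0_iff)
  hence "1 \<le> (\<Prod>i<n. real (card (V i)))" by (intro prod_ge_1) auto
  hence "1 * dr_gauge_value G n \<le> (\<Prod>i<n. real (card (V i))) * dr_gauge_value G n"
    using gauge_value_pos[of n] by (intro mult_right_mono) auto
  thus ?thesis by (simp add: gauge_value_eq)
qed

section \<open>Null sets obtained from independent sets\<close>

definition box :: "nat \<Rightarrow> (nat \<Rightarrow> 'v) \<Rightarrow> 'v set \<Rightarrow> (nat \<Rightarrow> 'v) set" where
  "box n p H = {x \<in> \<Omega>. restrict x {..<n} = p \<and> x n \<in> H}"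

text \<open>The lower bound on the diameter comes from an edge of the next graph.\<close>

lemma ediam_box:
  assumes p: "p \<in> (\<Pi>\<^sub>E i\<in>{..<n}. V i)" and H: "indep_set (dr_graph G n) H" "H \<noteq> {}"
  shows "ediam (dr_dist G) (box n p H) = ennreal ((1/2) ^ n)"
proof (rule antisym)
  have "dr_dist G x y \<le> (1/2) ^ n" if "x \<in> box n p H" "y \<in> box n p H" for x y
  proof -
    have "restrict x {..<n} = restrict y {..<n}" using that by (simp add: box_def)
    hence "x i = y i" if "i < n" for i using that by (metis lessThan_iff restrict_apply')
    thus ?thesis using that H(1) by (auto simp: dist_le_iff box_def indep_set_def)
  qed
  thus "ediam (dr_dist G) (box n p H) \<le> ennreal ((1/2) ^ n)"
    unfolding ediam_le_iff by (intro ballI ennreal_leI)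
  obtain a where a: "a \<in> H" using H(2) by blast
  obtain u v where uv: "u \<in> V (Suc n)" "v \<in> V (Suc n)" "(u, v) \<in> parcs (dr_graph G (Suc n))"
    by (rule ex_edge)
  have "u \<noteq> v" using uv no_loop by blast
  \<comment> \<open>\<open>x u\<close> and \<open>x v\<close> agree up to coordinate
    \<open>n\<close> and are adjacent at \<open>Suc n\<close>, so their distance is
    \<open>2 * (1/2) ^ Suc n\<close>.\<close>
  define z where "z = (\<lambda>i. if i < n then p i else SOME b. b \<in> V i)"
  define x where "x b = z(n := a, Suc n := b)" for b
  have z: "z i \<in> V i" for i
    using PiE_mem[OF p, of i] V_nonempty[of i] by (auto simp: z_def some_in_eq)
  have x: "x b \<in> box n p H" if "b \<in> V (Suc n)" for b
  proof -
    have "x b \<in> \<Omega>" using z H(1) a that by (auto simp: x_def mem_space_iff indep_set_def)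
    moreover have "restrict (x b) {..<n} = p"
      using p by (auto simp: x_def z_def fun_eq_iff restrict_def PiE_iff extensional_def)
    ultimately show ?thesis using a by (simp add: box_def x_def)
  qed
  have "dr_dist G (x u) (x v) = (1/2) ^ n"
    using uv \<open>u \<noteq> v\<close> by (subst dist_eq[of _ "Suc n"]) (auto simp: x_def)
  thus "ennreal ((1/2) ^ n) \<le> ediam (dr_dist G) (box n p H)"
    using le_ediam[OF x x, of u v "dr_dist G"] uv by simp
qed

text \<open>Every point satisfies the condition at some level \<open>n \<ge> m\<close>, so the boxes
  of these levels cover. Level \<open>n\<close> costs \<open>(1/2) ^ n\<close>, and the geometric
  series from \<open>m\<close> on gives the bound.\<close>

lemma hausdorff_pre_frequently:
  assumes H: "\<And>n. indep_set (dr_graph G n) (H n)" "\<And>n. H n \<noteq> {}" and m: "(1/2) ^ m \<le> \<delta>"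
  shows "hausdorff_pre \<Omega> (dr_dist G) (dr_gauge G) \<delta> {x \<in> \<Omega>. \<exists>\<^sub>F n in sequentially. x n \<in> H n}
      \<le> ennreal (2 * (1/2) ^ m)"
proof -
  let ?P = "\<lambda>n. \<Pi>\<^sub>E i\<in>{..<n}. V i"
  have fin: "finite (?P n)" for n by (intro finite_PiE) (auto simp: finite_V)
  have "\<forall>n. \<exists>f. bij_betw f {0..<card (?P n)} (?P n)" using ex_bij_betw_nat_finite[OF fin] by blast
  then obtain f where f: "\<And>n. bij_betw (f n) {0..<card (?P n)} (?P n)" by metis
  \<comment> \<open>Row \<open>k\<close> lists the boxes of level \<open>m + k\<close>, padded by
    empty sets of gauge 0; \<open>prod_decode\<close> merges the rows into one sequence.\<close>
  define D where "D = (\<lambda>(k, j). if j < card (?P (m + k)) then box (m + k) (f (m + k) j) (H (m + k)) else {})"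
  define C where "C i = D (prod_decode i)" for i
  have diam: "ediam (dr_dist G) (D (k, j)) = (if j < card (?P (m + k)) then ennreal ((1/2) ^ (m + k)) else 0)"
    for k j
  proof (cases "j < card (?P (m + k))")
    case True
    hence "f (m + k) j \<in> ?P (m + k)" by (intro bij_betw_apply[OF f]) simp
    from ediam_box[OF this H] True show ?thesis by (simp add: D_def)
  qed (simp add: D_def)
  have "ediam (dr_dist G) (D kj) \<le> ennreal \<delta>" for kj
  proof (cases kj)
    case (Pair k j)
    have "(1/2::real) ^ (m + k) \<le> (1/2) ^ m" by (intro power_decreasing) auto
    hence "(1/2) ^ (m + k) \<le> \<delta>" using m by linarith
    thus ?thesis unfolding Pair diam by (simp add: ennreal_leI)
  qed
  hence "\<And>i. ediam (dr_dist G) (C i) \<le> ennreal \<delta>" by (simp add: C_def)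
  moreover have "D kj \<subseteq> \<Omega>" for kj by (cases kj) (auto simp: D_def box_def)
  hence "\<And>i. C i \<subseteq> \<Omega>" by (simp add: C_def)
  moreover have "{x \<in> \<Omega>. \<exists>\<^sub>F n in sequentially. x n \<in> H n} \<subseteq> (\<Union>i. C i)"
  proof
    fix x assume "x \<in> {x \<in> \<Omega>. \<exists>\<^sub>F n in sequentially. x n \<in> H n}"
    hence x: "x \<in> \<Omega>" "\<exists>\<^sub>F n in sequentially. x n \<in> H n" by auto
    then obtain n where n: "n \<ge> m" "x n \<in> H n" unfolding frequently_sequentially by blast
    have "restrict x {..<n} \<in> ?P n" using x(1) by (auto simp: mem_space_iff)
    hence "restrict x {..<n} \<in> f n ` {0..<card (?P n)}"
      by (simp only: bij_betw_imp_surj_on[OF f[of n]])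
    then obtain j where "j < card (?P n)" "f n j = restrict x {..<n}" by auto
    hence "x \<in> D (n - m, j)" using n x(1) by (simp add: D_def box_def)
    hence "x \<in> C (prod_encode (n - m, j))" by (simp add: C_def)
    thus "x \<in> (\<Union>i. C i)" by blast
  qed
  ultimately have "hausdorff_pre \<Omega> (dr_dist G) (dr_gauge G) \<delta> {x \<in> \<Omega>. \<exists>\<^sub>F n in sequentially. x n \<in> H n}
      \<le> (\<Sum>i. ennreal (dr_gauge G (enn2real (ediam (dr_dist G) (C i)))))"
    unfolding hausdorff_pre_def by (intro INF_lower) auto
  also have "\<dots> = (\<Sum>k. ennreal ((1/2) ^ (m + k)))"
    unfolding C_def
  proof (rule suminf_ennreal_2dimen)
    fix k
    have "(\<Sum>j. ennreal (dr_gauge G (enn2real (ediam (dr_dist G) (D (k, j)))))) =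
        (\<Sum>j. if j < card (?P (m + k)) then ennreal (dr_gauge_value G (m + k)) else 0)"
      by (intro suminf_cong) (simp add: diam dr_gauge_dyadic)
    also have "\<dots> = (\<Sum>j<card (?P (m + k)). ennreal (dr_gauge_value G (m + k)))"
      by (subst suminf_finite[of "{..<card (?P (m + k))}"]) auto
    also have "\<dots> = ennreal (real (card (?P (m + k))) * dr_gauge_value G (m + k))"
      using gauge_value_pos[of "m + k"] by (simp add: ennreal_mult' ennreal_of_nat_eq_real_of_nat)
    also have "real (card (?P (m + k))) * dr_gauge_value G (m + k) = (1/2) ^ (m + k)"
      using gauge_value_eq[of "m + k"] by (simp add: card_PiE)
    finally show "ennreal ((1/2) ^ (m + k)) =
        (\<Sum>j. ennreal (dr_gauge G (enn2real (ediam (dr_dist G) (D (k, j))))))" ..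
  qed
  also have "\<dots> = ennreal (2 * (1/2) ^ m)"
  proof (rule suminf_ennreal_eq)
    have "(\<lambda>k. (1/2) ^ m * (1/2::real) ^ k) sums ((1/2) ^ m * (1 / (1 - 1/2)))"
      by (intro sums_mult geometric_sums) simp
    thus "(\<lambda>k. (1/2) ^ (m + k)) sums (2 * (1/2::real) ^ m)" by (simp add: power_add mult.commute)
  qed simp
  finally show ?thesis .
qed

lemma frequently_in_dr_null:
  assumes H: "\<And>n. indep_set (dr_graph G n) (H n)" "\<And>n. H n \<noteq> {}"
  shows "{x \<in> \<Omega>. \<exists>\<^sub>F n in sequentially. x n \<in> H n} \<in> dr_null G"
proof -
  let ?A = "{x \<in> \<Omega>. \<exists>\<^sub>F n in sequentially. x n \<in> H n}"
  let ?h = "\<lambda>\<delta>. hausdorff_pre \<Omega> (dr_dist G) (dr_gauge G) \<delta> ?A"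
  have "?h \<delta> \<le> 0" if "\<delta> > 0" for \<delta>
  proof (rule tendsto_lowerbound)
    have lim: "(\<lambda>m. (1/2::real) ^ m) \<longlonglongrightarrow> 0" by (intro LIMSEQ_power_zero) auto
    from tendsto_ennrealI[OF tendsto_mult_right_zero[OF this, of 2]]
    show "(\<lambda>m. ennreal (2 * (1/2) ^ m)) \<longlonglongrightarrow> 0" by simp
    from order_tendstoD(2)[OF lim that]
    show "eventually (\<lambda>m. ?h \<delta> \<le> ennreal (2 * (1/2) ^ m)) sequentially"
      by eventually_elim (intro hausdorff_pre_frequently H, simp)
  qed simp
  hence "hausdorff_measure \<Omega> (dr_dist G) (dr_gauge G) ?A = 0"
    by (simp add: hausdorff_measure_def SUP_eq_const)
  thus ?thesis by (simp add: dr_null_def hausdorff_null_def)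
qed

section \<open>The space is not null\<close>

lemma ediam_dyadic:
  assumes C: "ediam (dr_dist G) C \<le> 1" and ab: "a \<in> C" "b \<in> C" "a \<noteq> b"
  obtains n where "ediam (dr_dist G) C = ennreal ((1/2) ^ n)"
proof -
  have le1: "dr_dist G x y \<le> 1" if "x \<in> C" "y \<in> C" for x y
    using C that by (simp add: ediam_le_iff)
  \<comment> \<open>The least exponent occurring in \<open>C\<close> gives the largest distance, so
    the supremum is attained.\<close>
  let ?P = "\<lambda>n. \<exists>x\<in>C. \<exists>y\<in>C. dr_dist G x y = (1/2) ^ n"
  have "\<exists>n. ?P n" using dist_dyadic[OF ab(3) le1] ab by metis
  then obtain n where n: "?P n" "\<And>m. m < n \<Longrightarrow> \<not> ?P m" using exists_least_iff[of ?P] by auto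
  have "dr_dist G x y \<le> (1/2) ^ n" if "x \<in> C" "y \<in> C" for x y
  proof (cases "x = y")
    case False
    have "dr_dist G x y \<le> 1" using le1 that by blast
    then obtain m where m: "dr_dist G x y = (1/2) ^ m"
      using dist_dyadic[OF False] by blast
    hence "n \<le> m" using n(2)[of m] that by (meson not_le)
    thus ?thesis unfolding m by (intro power_decreasing) auto
  qed simp
  hence "ediam (dr_dist G) C \<le> ennreal ((1/2) ^ n)"
    by (auto simp: ediam_le_iff intro!: ennreal_leI)
  moreover have "ennreal ((1/2) ^ n) \<le> ediam (dr_dist G) C" using n(1) le_ediam by metis
  ultimately show ?thesis using that antisym by blast
qed

text \<open>Assigns a level to a covering set. With two points its gauge is exactly some
  \<open>dr_gauge_value G n\<close>; the slack \<open>e\<close> pays for sets with at most one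
  point, whose gauge is 0 while every level has positive value.\<close>

lemma gauge_value_le_gauge_ediam:
  assumes C: "ediam (dr_dist G) C \<le> 1" and e: "e > 0"
  obtains n where "\<And>x y. x \<in> C \<Longrightarrow> y \<in> C \<Longrightarrow> dr_dist G x y \<le> (1/2) ^ n"
    and "ennreal (dr_gauge_value G n) \<le> ennreal (dr_gauge G (enn2real (ediam (dr_dist G) C))) + ennreal e"
proof (cases "\<exists>a\<in>C. \<exists>b\<in>C. a \<noteq> b")
  case True
  then obtain n where n: "ediam (dr_dist G) C = ennreal ((1/2) ^ n)" using ediam_dyadic[OF C] by metis
  hence "dr_dist G x y \<le> (1/2) ^ n" if "x \<in> C" "y \<in> C" for x y
    using ediam_le_iff[of "dr_dist G" C "ennreal ((1/2) ^ n)"] that by simp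
  thus ?thesis by (rule that) (simp_all add: n dr_gauge_dyadic)
next
  case False
  obtain n where n: "(1/2::real) ^ n < e" using real_arch_pow_inv[OF e, of "1/2"] by auto
  show ?thesis
  proof (rule that)
    show "dr_dist G x y \<le> (1/2) ^ n" if "x \<in> C" "y \<in> C" for x y
      using False that by (cases "x = y") auto
    have "ennreal (dr_gauge_value G n) \<le> ennreal e"
      using gauge_value_le[of n] n by (intro ennreal_leI) simp
    thus "ennreal (dr_gauge_value G n) \<le>
        ennreal (dr_gauge G (enn2real (ediam (dr_dist G) C))) + ennreal e"
      by (simp add: add_increasing)
  qed
qed

text \<open>
  A point outside all \<open>C k\<close> is built coordinate by coordinate. The weight of those pieces
  that are still compatible with the first \<open>l\<close> coordinates is kept below
  \<open>1 / (M\<^sub>0 \<dots> M\<^sub>l\<^sub>-\<^sub>1)\<close>. If no vertex could serve as the next coordinate, the pieces of level \<open>l\<close>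
  together with the singletons of the remaining vertices would cover the graph by fewer than
  \<open>M\<^sub>l\<close> independent sets.
\<close>

lemma ex_uncovered_point:
  fixes C :: "nat \<Rightarrow> (nat \<Rightarrow> 'v) set" and lev :: "nat \<Rightarrow> nat"
  assumes C: "\<And>k. C k \<subseteq> \<Omega>"
    and small: "\<And>k x y. x \<in> C k \<Longrightarrow> y \<in> C k \<Longrightarrow> dr_dist G x y \<le> (1/2) ^ lev k"
    and sum: "(\<Sum>k. if C k = {} then 0 else ennreal (dr_gauge_value G (lev k))) < 1"
  obtains x where "x \<in> \<Omega>" "\<And>k. x \<notin> C k"
proof -
  define w where "w k = (if C k = {} then 0 else ennreal (dr_gauge_value G (lev k)))" for k
  define \<mu> where "\<mu> = density (count_space UNIV) w"
  have [simp]: "sets \<mu> = UNIV" by (simp add: \<mu>_def)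
  \<comment> \<open>\<open>v 0 = 1\<close> matches the bound on the total weight, and
    \<open>v (Suc l)\<close> is the weight of one nonempty piece of level \<open>l\<close>.\<close>
  define v where "v l = 1 / (\<Prod>i<l. real (dr_M G i))" for l
  have v_Suc: "v (Suc l) = dr_gauge_value G l" for l
    by (simp add: v_def dr_gauge_value_def lessThan_Suc_atMost)
  have v_pos: "v l > 0" for l unfolding v_def using M_pos by (simp add: prod_pos)
  have v_eq: "v l = real (dr_M G l) * v (Suc l)" for l using M_pos[of l] by (simp add: v_def)
  define S where "S l s = {k. l \<le> lev k \<and> (\<exists>x\<in>C k. \<forall>i<l. x i = s i)}" for l s
  have agree: "x i = y i" if "x \<in> C k" "y \<in> C k" "i < lev k" for x y i k
    using small[OF that(1,2)] that(3) by (simp add: dist_le_iff)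

  have step: "\<exists>g\<in>V l. (\<forall>k\<in>S l s. lev k = l \<longrightarrow> g \<notin> (\<lambda>x. x l) ` C k) \<and>
      emeasure \<mu> (S (Suc l) (s(l := g))) < ennreal (v (Suc l))"
    if less: "emeasure \<mu> (S l s) < ennreal (v l)" for l s
  proof (rule ccontr)
    assume contr: "\<not> ?thesis"
    \<comment> \<open>\<open>K\<close> holds the compatible pieces of level \<open>l\<close>, and
      \<open>U\<close> the vertices they leave free. By assumption each free \<open>g\<close> has
      weight at least \<open>v (Suc l)\<close> in \<open>B g\<close>, so it costs at least as much
      as a piece in \<open>K\<close>.\<close>
    define K where "K = {k \<in> S l s. lev k = l}"
    define U where "U = V l - (\<Union>k\<in>K. (\<lambda>x. x l) ` C k)"
    define B where "B g = S (Suc l) (s(l := g))" for g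
    let ?c = "ennreal (v (Suc l))"
    have U: "finite U" "U \<subseteq> V l" using finite_V by (auto simp: U_def)
    have B_ge: "?c \<le> emeasure \<mu> (B g)" if "g \<in> U" for g
    proof -
      have "g \<in> V l" "\<forall>k\<in>S l s. lev k = l \<longrightarrow> g \<notin> (\<lambda>x. x l) ` C k"
        using that unfolding U_def K_def by blast+
      with contr show ?thesis unfolding B_def by (meson not_le)
    qed
    \<comment> \<open>Counting measure stands in for \<open>card K\<close> until the weight bound
      shows that \<open>K\<close> is finite.\<close>
    have K_eq: "emeasure \<mu> K = ?c * emeasure (count_space UNIV) K"
    proof -
      have "emeasure \<mu> K = (\<integral>\<^sup>+k. w k * indicator K k \<partial>count_space UNIV)"
        by (simp add: \<mu>_def emeasure_density)
      also have "\<dots> = (\<integral>\<^sup>+k. ?c * indicator K k \<partial>count_space UNIV)"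
        by (intro nn_integral_cong) (auto simp: w_def K_def S_def v_Suc indicator_def)
      finally show ?thesis by (simp add: nn_integral_cmult_indicator)
    qed
    \<comment> \<open>All points of a piece of level above \<open>l\<close> share coordinate
      \<open>l\<close>, so it is compatible with at most one \<open>g\<close>.\<close>
    have B_disj: "B g \<inter> B g' = {}" if "g \<noteq> g'" for g g'
    proof -
      have False if k: "k \<in> B g" "k \<in> B g'" for k
      proof -
        from k obtain x y where "x \<in> C k" "y \<in> C k" "x l = g" "y l = g'" "Suc l \<le> lev k"
          unfolding B_def S_def by auto
        thus False using agree[of x k y l] \<open>g \<noteq> g'\<close> by simp
      qed
      thus ?thesis by blast
    qed
    have B_sub: "B g \<subseteq> S l s" for g
    proof
      fix k assume "k \<in> B g"
      then obtain x where x: "Suc l \<le> lev k" "x \<in> C k" "\<forall>i<Suc l. x i = (s(l := g)) i"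
        unfolding B_def S_def by blast
      have "x i = s i" if "i < l" for i using x(3)[rule_format, of i] that by simp
      thus "k \<in> S l s" using x(1,2) unfolding S_def by auto
    qed
    have "emeasure \<mu> K + (\<Sum>g\<in>U. emeasure \<mu> (B g)) = emeasure \<mu> K + emeasure \<mu> (\<Union>g\<in>U. B g)"
      using U(1) B_disj by (subst sum_emeasure) (auto simp: disjoint_family_on_def)
    also have "\<dots> = emeasure \<mu> (K \<union> (\<Union>g\<in>U. B g))"
      by (rule plus_emeasure) (auto simp: K_def B_def S_def)
    also have "\<dots> \<le> emeasure \<mu> (S l s)"
      using B_sub by (intro emeasure_mono) (auto simp: K_def)
    finally have "emeasure \<mu> K + (\<Sum>g\<in>U. ?c) \<le> emeasure \<mu> (S l s)"
      using sum_mono[OF B_ge, of U "\<lambda>g. g"] by (meson add_left_mono order_trans)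
    hence lt: "?c * emeasure (count_space UNIV) K + (\<Sum>g\<in>U. ?c) < ennreal (v l)"
      using less K_eq by simp
    have finK: "finite K"
    proof (rule ccontr)
      assume "infinite K"
      hence "?c * emeasure (count_space UNIV) K = \<infinity>"
        using v_pos[of "Suc l"] by (simp add: ennreal_mult_top)
      thus False using lt by simp
    qed
    have "?c * emeasure (count_space UNIV) K + (\<Sum>g\<in>U. ?c) = ennreal (v (Suc l) * real (card K + card U))"
      using v_pos[of "Suc l"] finK
      by (simp add: ennreal_of_nat_eq_real_of_nat ennreal_mult'[symmetric] ennreal_plus[symmetric]
          algebra_simps del: ennreal_plus)
    hence "v (Suc l) * real (card K + card U) < v (Suc l) * real (dr_M G l)"
      using lt v_pos[of l] v_pos[of "Suc l"] by (simp add: v_eq[of l] ennreal_less_iff mult.commute)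
    hence card: "card K + card U < dr_M G l"
      using v_pos[of "Suc l"] by simp
    let ?\<H> = "(\<lambda>k. (\<lambda>x. x l) ` C k) ` K \<union> (\<lambda>g. {g}) ` U"
    have "dr_M G l < card ?\<H>"
    proof (rule card_indep_cover[OF graph])
      show "finite ?\<H>" using finK U by simp
      show "V l \<subseteq> \<Union>?\<H>" by (auto simp: U_def)
      fix H assume "H \<in> ?\<H>"
      thus "indep_set (dr_graph G l) H"
      proof
        assume "H \<in> (\<lambda>k. (\<lambda>x. x l) ` C k) ` K"
        then obtain k where k: "lev k = l" "H = (\<lambda>x. x l) ` C k" by (auto simp: K_def)
        show ?thesis unfolding indep_set_def k(2)
        proof (intro conjI ballI)
          show "(\<lambda>x. x l) ` C k \<subseteq> V l" using C[of k] by (auto simp: mem_space_iff)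
          fix u v assume "u \<in> (\<lambda>x. x l) ` C k" "v \<in> (\<lambda>x. x l) ` C k"
          thus "(u, v) \<notin> parcs (dr_graph G l)"
            using small[of _ k] by (auto simp: k(1) dist_le_iff)
        qed
      next
        assume "H \<in> (\<lambda>g. {g}) ` U"
        thus ?thesis using U(2) no_loop by (auto simp: indep_set_def)
      qed
    qed
    moreover have "card ?\<H> \<le> card K + card U"
      by (rule order_trans[OF card_Un_le]) (intro add_mono card_image_le finK U(1))
    ultimately show False using card by linarith
  qed

  let ?P = "\<lambda>l s. emeasure \<mu> (S l s) < ennreal (v l)"
  let ?Q = "\<lambda>l s s'. \<exists>g\<in>V l. s' = s(l := g) \<and> (\<forall>k\<in>S l s. lev k = l \<longrightarrow> g \<notin> (\<lambda>x. x l) ` C k)"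
  have "\<exists>\<sigma>. \<forall>l. ?P l (\<sigma> l) \<and> ?Q l (\<sigma> l) (\<sigma> (Suc l))"
  proof (rule dependent_nat_choice)
    \<comment> \<open>Stage 0 constrains no coordinate, so any start value works.\<close>
    have "emeasure \<mu> (S 0 undefined) \<le> emeasure \<mu> UNIV" by (intro emeasure_mono) auto
    also have "\<dots> = (\<Sum>k. w k)"
      by (simp add: \<mu>_def emeasure_density nn_integral_count_space_nat)
    also have "\<dots> < 1" using sum by (simp add: w_def)
    finally show "\<exists>s. ?P 0 s" by (auto simp: v_def)
  next
    fix s l assume "?P l s"
    from step[OF this] show "\<exists>s'. ?P (Suc l) s' \<and> ?Q l s s'" by blast
  qed
  then obtain \<sigma> where \<sigma>: "\<And>l. ?Q l (\<sigma> l) (\<sigma> (Suc l))" by blast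
  \<comment> \<open>Stage \<open>i\<close> fixes coordinate \<open>i\<close>, and later stages leave
    it unchanged.\<close>
  define x where "x i = \<sigma> (Suc i) i" for i
  have prefix: "\<sigma> l i = x i" if "i < l" for l i
    using that
  proof (induction l)
    case (Suc l)
    show ?case
    proof (cases "i = l")
      case False
      thus ?thesis using \<sigma>[of l] Suc by auto
    qed (simp add: x_def)
  qed simp
  have x: "x l \<in> V l" "\<And>k. k \<in> S l (\<sigma> l) \<Longrightarrow> lev k = l \<Longrightarrow> x l \<notin> (\<lambda>x. x l) ` C k" for l
    using \<sigma>[of l] by (auto simp: x_def)
  show ?thesis
  proof (rule that)
    show "x \<in> \<Omega>" using x(1) by (simp add: mem_space_iff)
    fix k
    show "x \<notin> C k"
    proof
      assume k: "x \<in> C k"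
      \<comment> \<open>If \<open>x\<close> were in \<open>C k\<close>, piece \<open>k\<close> would
        still be compatible at stage \<open>lev k\<close>, where the new coordinate avoids its
        projection.\<close>
      hence "k \<in> S (lev k) (\<sigma> (lev k))" by (auto simp: S_def prefix intro!: bexI[of _ x])
      from x(2)[OF this refl] k show False by blast
    qed
  qed
qed

lemma space_notin_dr_null: "\<Omega> \<notin> dr_null G"
proof
  assume "\<Omega> \<in> dr_null G"
  hence "hausdorff_measure \<Omega> (dr_dist G) (dr_gauge G) \<Omega> = 0"
    by (simp add: dr_null_def hausdorff_null_def)
  moreover have "hausdorff_pre \<Omega> (dr_dist G) (dr_gauge G) 1 \<Omega> \<le>
      hausdorff_measure \<Omega> (dr_dist G) (dr_gauge G) \<Omega>"
    unfolding hausdorff_measure_def by (rule SUP_upper) simp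
  moreover have "0 < ennreal (1/2)" by (subst ennreal_less_zero_iff) simp
  ultimately have "hausdorff_pre \<Omega> (dr_dist G) (dr_gauge G) 1 \<Omega> < ennreal (1/2)"
    by (metis le_zero_eq)
  then obtain C where C: "\<And>k. C k \<subseteq> \<Omega>" "\<Omega> \<subseteq> (\<Union>k. C k)" "\<And>k. ediam (dr_dist G) (C k) \<le> 1"
    and sum: "(\<Sum>k. ennreal (dr_gauge G (enn2real (ediam (dr_dist G) (C k))))) < ennreal (1/2)"
    unfolding hausdorff_pre_def INF_less_iff by auto
  let ?h = "\<lambda>k. ennreal (dr_gauge G (enn2real (ediam (dr_dist G) (C k))))"
  \<comment> \<open>The gauge sum is below 1/2, and the slacks sum to 1/2, so the weights stay below
    1.\<close>
  have "\<exists>n. (\<forall>x\<in>C k. \<forall>y\<in>C k. dr_dist G x y \<le> (1/2) ^ n) \<and>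
      ennreal (dr_gauge_value G n) \<le> ?h k + ennreal (1/2 * (1/2) ^ Suc k)" for k
    by (rule gauge_value_le_gauge_ediam[OF C(3)[of k], of "1/2 * (1/2) ^ Suc k"]) auto
  then obtain lev where lev: "\<And>k x y. x \<in> C k \<Longrightarrow> y \<in> C k \<Longrightarrow> dr_dist G x y \<le> (1/2) ^ lev k"
    "\<And>k. ennreal (dr_gauge_value G (lev k)) \<le> ?h k + ennreal (1/2 * (1/2) ^ Suc k)" by metis
  have "(\<Sum>k. if C k = {} then 0 else ennreal (dr_gauge_value G (lev k))) \<le>
      (\<Sum>k. ?h k + ennreal (1/2 * (1/2) ^ Suc k))"
    using lev(2) by (intro suminf_le) auto
  also have "\<dots> = (\<Sum>k. ?h k) + (\<Sum>k. ennreal (1/2 * (1/2) ^ Suc k))"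
    by (rule suminf_add[symmetric]) auto
  also have "(\<Sum>k. ennreal (1/2 * (1/2) ^ Suc k)) = ennreal (1/2)"
    using sums_mult[OF power_half_series, of "1/2"] by (intro suminf_ennreal_eq) auto
  also have "(\<Sum>k. ?h k) + ennreal (1/2) < ennreal (1/2) + ennreal (1/2)"
    using sum by (simp add: ennreal_add_left_cancel_less add.commute)
  also have "\<dots> = ennreal (1/2 + 1/2)" by (rule ennreal_plus[symmetric]) auto
  also have "\<dots> = 1" by simp
  finally obtain x where "x \<in> \<Omega>" "\<And>k. x \<notin> C k"
    using ex_uncovered_point[of C lev, OF C(1) lev(1)] by metis
  thus False using C(2) by blast
qed

section \<open>The relation between the two spaces\<close>

lemma null_relation:
  obtains R :: "(nat \<Rightarrow> 'v) \<Rightarrow> (nat \<Rightarrow> bool) \<Rightarrow> bool"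
  where "\<And>z. {x \<in> \<Omega>. R x z} \<in> dr_null G"
    and "\<And>x. x \<in> \<Omega> \<Longrightarrow> {z. \<not> R x z} \<in> closed_null_ideal"
proof -
  have "\<forall>n. \<exists>H. (\<forall>x\<in>V n. indep_set (dr_graph G n) (H x) \<and> x \<in> H x) \<and>
      (\<forall>a\<in>V n. real (card {x \<in> V n. a \<in> H x}) \<ge> 1/4 * real (card (V n)))"
    using graph unfolding davies_rogers_graph_def by (intro allI) (elim meta_allE conjE)
  from choice[OF this] obtain H where H': "\<forall>n. (\<forall>x\<in>V n. indep_set (dr_graph G n) (H n x) \<and> x \<in> H n x) \<and>
      (\<forall>a\<in>V n. real (card {x \<in> V n. a \<in> H n x}) \<ge> 1/4 * real (card (V n)))" ..
  have H: "indep_set (dr_graph G n) (H n x)" "x \<in> H n x"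
    "real (card {x' \<in> V n. x \<in> H n x'}) \<ge> 1/4 * real (card (V n))" if "x \<in> V n" for n x
    using H' that by blast+
  have "\<forall>n. \<exists>k. \<forall>J::nat set. finite J \<longrightarrow> card J = k \<longrightarrow> (\<exists>f. (\<forall>s. f s \<in> V n) \<and>
      (\<forall>a\<in>V n. real (card {s \<in> J \<rightarrow>\<^sub>E (UNIV::bool set). a \<notin> H n (f s)}) \<le> 7/8 * 2 ^ card J))"
    by (rule allI, rule ex_bit_coding[OF finite_V V_nonempty H(3)])
  from choice[OF this] obtain k where k: "\<forall>n. \<forall>J::nat set. finite J \<longrightarrow> card J = k n \<longrightarrow> (\<exists>f. (\<forall>s. f s \<in> V n) \<and>
      (\<forall>a\<in>V n. real (card {s \<in> J \<rightarrow>\<^sub>E (UNIV::bool set). a \<notin> H n (f s)}) \<le> 7/8 * 2 ^ card J))" ..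
  define J where "J n = prod_encode ` ({n} \<times> {..<k n})" for n
  have J: "finite (J n)" "card (J n) = k n" for n
    by (auto simp: J_def card_image inj_prod_encode)
  have disj: "disjoint_family J"
    by (auto simp: disjoint_family_on_def J_def)
  have "\<forall>n. \<exists>f. (\<forall>s. f s \<in> V n) \<and>
      (\<forall>a\<in>V n. real (card {s \<in> J n \<rightarrow>\<^sub>E (UNIV::bool set). a \<notin> H n (f s)}) \<le> 7/8 * 2 ^ card (J n))"
    using k J by blast
  from choice[OF this] obtain f where f': "\<forall>n. (\<forall>s. f n s \<in> V n) \<and>
      (\<forall>a\<in>V n. real (card {s \<in> J n \<rightarrow>\<^sub>E (UNIV::bool set). a \<notin> H n (f n s)}) \<le> 7/8 * 2 ^ card (J n))" ..
  have f: "f n s \<in> V n"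
    "a \<in> V n \<Longrightarrow> real (card {s \<in> J n \<rightarrow>\<^sub>E (UNIV::bool set). a \<notin> H n (f n s)}) \<le> 7/8 * 2 ^ card (J n)"
    for n s a using f' by blast+
  let ?R = "\<lambda>x z. \<exists>\<^sub>F n in sequentially. x n \<in> H n (f n (restrict z (J n)))"
  show ?thesis
  proof (rule that)
    show "{x \<in> \<Omega>. ?R x z} \<in> dr_null G" for z
    proof (rule frequently_in_dr_null)
      fix n
      show "indep_set (dr_graph G n) (H n (f n (restrict z (J n))))" by (rule H(1)[OF f(1)])
      show "H n (f n (restrict z (J n))) \<noteq> {}" using H(2)[OF f(1)] by blast
    qed
  next
    fix x assume x: "x \<in> \<Omega>"
    \<comment> \<open>The failing patterns of block \<open>n\<close>: lying in \<open>T n\<close>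
      eventually is exactly the negation of \<open>?R x z\<close>.\<close>
    define T where "T n = {s \<in> J n \<rightarrow>\<^sub>E UNIV. x n \<notin> H n (f n s)}" for n
    have "{z. \<forall>\<^sub>F n in sequentially. restrict z (J n) \<in> T n} \<in> closed_null_ideal"
    proof (rule closed_null_ideal_blocks[OF disj J(1)])
      fix n
      have "measure cantor_measure {z. restrict z (J n) \<in> T n} = real (card (T n)) / 2 ^ card (J n)"
        by (rule measure_cantor_restrict[OF J(1)]) (auto simp: T_def)
      also have "\<dots> \<le> 7/8"
        using f(2)[of "x n" n] x by (simp add: T_def mem_space_iff divide_le_eq)
      finally show "measure cantor_measure {z. restrict z (J n) \<in> T n} \<le> 7/8" .
    qed simp
    also have "{z. \<forall>\<^sub>F n in sequentially. restrict z (J n) \<in> T n} = {z. \<not> ?R x z}"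
      by (simp add: not_frequently T_def)
    finally show "{z. \<not> ?R x z} \<in> closed_null_ideal" .
  qed
qed

end

theorem theorem15:
  fixes G :: "nat \<Rightarrow> 'v pair_pre_digraph"
  assumes "\<And>n. n > 0 \<Longrightarrow> davies_rogers_graph n (G n)"
  shows "cov (dr_space G) (dr_null G) \<le>o non UNIV closed_null_ideal \<and>
         cov UNIV closed_null_ideal \<le>o non (dr_space G) (dr_null G)"
proof -
  interpret davies_rogers_space G by unfold_locales (rule assms)
  obtain R :: "(nat \<Rightarrow> 'v) \<Rightarrow> (nat \<Rightarrow> bool) \<Rightarrow> bool"
    where R: "\<And>z. {x \<in> \<Omega>. R x z} \<in> dr_null G"
      "\<And>x. x \<in> \<Omega> \<Longrightarrow> {z. \<not> R x z} \<in> closed_null_ideal"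
    by (rule null_relation) (rule that)
  have E_subset: "B \<in> closed_null_ideal" if "A \<in> closed_null_ideal" "B \<subseteq> A" for A B
    using that unfolding closed_null_ideal_def by (rule sigma_ideal_generated_subset)
  have N_subset: "B \<in> dr_null G" if "A \<in> dr_null G" "B \<subseteq> A" for A B
    using that unfolding dr_null_def by (rule hausdorff_null_subset)
  have "cov \<Omega> (dr_null G) \<le>o non UNIV closed_null_ideal"
  proof (rule cov_le_non)
    show "{x \<in> \<Omega>. R x z} \<in> dr_null G" for z by (rule R)
    show "{z \<in> UNIV. \<not> R x z} \<in> closed_null_ideal" if "x \<in> \<Omega>" for x using R(2)[OF that] by simp
  qed (fact E_subset UNIV_notin_closed_null_ideal)+
  \<comment> \<open>The converse relation, negated: points of \<open>\<Omega>\<close> now index the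
    cover, and \<open>space_notin_dr_null\<close> ensures that \<open>non\<close> is
    attained.\<close>
  moreover have "cov UNIV closed_null_ideal \<le>o non \<Omega> (dr_null G)"
  proof (rule cov_le_non)
    show "{z \<in> UNIV. \<not> R x z} \<in> closed_null_ideal" if "x \<in> \<Omega>" for x using R(2)[OF that] by simp
    show "{x \<in> \<Omega>. \<not> \<not> R x z} \<in> dr_null G" for z using R(1)[of z] by simp
  qed (fact N_subset space_notin_dr_null)+
  ultimately show ?thesis ..
qed

end
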